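(* Let $M$ be a Markov evolution algebra with set of generators $\{e_i\mid i\in\Lambda\}$ and let $C$ be a subset of $\{e_i\mid i\in\Lambda\}$. Then $C$ generates an evolution subalgebra of $M$ if and only if $n_{ij}=0$ for all $e_i\in C$, all $e_j\notin C$ and all $n\ge 1$, where the $n_{ij}$ are the elements of the matrix of $L^n$, $L$ being the evolution operator of $M$.
   Context: A Markov evolution algebra is a real algebra $M$ with a finite nonempty basis $\{e_i\mid i\in\Lambda\}$ (its set of generators) and products $e_i\cdot e_j=0$ for $i\ne j$, $e_i^2=\sum_{k\in\Lambda}p_{ik}e_k$, where $0\le p_{ik}\le 1$ and $\sum_{k\in\Lambda}p_{ik}=1$ for all $i$. Its evolution operator is the linear map $L$ with $L(e_i)=e_i^2$, and for $n\ge 1$ the coefficients $n_{ij}$ are defined by $L^n(e_i)=\sum_{j\in\Lambda}n_{ij}e_j$. An evolution subalgebra of $M$ is a subalgebra that is the linear span of $\{e_i : i\in\Lambda'\}$ for some $\Lambda'\subseteq\Lambda$; a set $C$ of generators "generates an evolution subalgebra" if the linear span of $C$ is a subalgebra of $M$. *)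

theory Defs
  imports "HOL-Analysis.Analysis"
begin

text \<open>
  The algebra is the whole type, a real vector space, equipped with a bilinear product that is
  not required to be associative or unital.  The generators are indexed injectively by the
  finite nonempty set \<open>\<Lambda>\<close>.
\<close>

locale markov_evolution_algebra =
  fixes mul :: "'a::real_vector \<Rightarrow> 'a \<Rightarrow> 'a"
    and \<Lambda> :: "'i set"
    and e :: "'i \<Rightarrow> 'a"
    and p :: "'i \<Rightarrow> 'i \<Rightarrow> real"
  assumes bilinear_mul: "bilinear mul"
    and finite_index: "finite \<Lambda>"
    and nonempty_index: "\<Lambda> \<noteq> {}"
    and inj_generators: "inj_on e \<Lambda>"
    and independent_generators: "independent (e ` \<Lambda>)"
    and span_generators: "span (e ` \<Lambda>) = UNIV"
    and mul_distinct: "\<And>i j. i \<in> \<Lambda> \<Longrightarrow> j \<in> \<Lambda> \<Longrightarrow> i \<noteq> j \<Longrightarrow> mul (e i) (e j) = 0"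
    and mul_self: "\<And>i. i \<in> \<Lambda> \<Longrightarrow> mul (e i) (e i) = (\<Sum>k\<in>\<Lambda>. p i k *\<^sub>R e k)"
    and prob_nonneg: "\<And>i k. i \<in> \<Lambda> \<Longrightarrow> k \<in> \<Lambda> \<Longrightarrow> 0 \<le> p i k"
    and prob_le_one: "\<And>i k. i \<in> \<Lambda> \<Longrightarrow> k \<in> \<Lambda> \<Longrightarrow> p i k \<le> 1"
    and prob_sum: "\<And>i. i \<in> \<Lambda> \<Longrightarrow> (\<Sum>k\<in>\<Lambda>. p i k) = 1"

definition evolution_operator ::
    "('a::real_vector \<Rightarrow> 'a \<Rightarrow> 'a) \<Rightarrow> 'i set \<Rightarrow> ('i \<Rightarrow> 'a) \<Rightarrow> 'a \<Rightarrow> 'a" where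
  "evolution_operator mul \<Lambda> e = construct (e ` \<Lambda>) (\<lambda>x. mul x x)"

text \<open>The coefficient \<open>n\<^sub>i\<^sub>j\<close> of \<open>e\<^sub>j\<close> in the basis expansion of \<open>L\<^sup>n(e\<^sub>i)\<close>:\<close>

definition evolution_coeff ::
    "('a::real_vector \<Rightarrow> 'a \<Rightarrow> 'a) \<Rightarrow> 'i set \<Rightarrow> ('i \<Rightarrow> 'a) \<Rightarrow> nat \<Rightarrow> 'i \<Rightarrow> 'i \<Rightarrow> real" where
  "evolution_coeff mul \<Lambda> e n i j =
     representation (e ` \<Lambda>) ((evolution_operator mul \<Lambda> e ^^ n) (e i)) (e j)"

definition is_subalgebra :: "('a::real_vector \<Rightarrow> 'a \<Rightarrow> 'a) \<Rightarrow> 'a set \<Rightarrow> bool" where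
  "is_subalgebra mul S \<longleftrightarrow> subspace S \<and> (\<forall>x\<in>S. \<forall>y\<in>S. mul x y \<in> S)"

definition evolution_subalgebra ::
    "('a::real_vector \<Rightarrow> 'a \<Rightarrow> 'a) \<Rightarrow> 'i set \<Rightarrow> ('i \<Rightarrow> 'a) \<Rightarrow> 'a set \<Rightarrow> bool" where
  "evolution_subalgebra mul \<Lambda> e S \<longleftrightarrow>
     is_subalgebra mul S \<and> (\<exists>\<Lambda>'\<subseteq>\<Lambda>. S = span (e ` \<Lambda>'))"

definition generates_evolution_subalgebra ::
    "('a::real_vector \<Rightarrow> 'a \<Rightarrow> 'a) \<Rightarrow> 'a set \<Rightarrow> bool" where
  "generates_evolution_subalgebra mul C \<longleftrightarrow> is_subalgebra mul (span C)"

lemma generates_evolution_subalgebra_iff: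
  assumes "C \<subseteq> e ` \<Lambda>"
  shows "generates_evolution_subalgebra mul C \<longleftrightarrow> evolution_subalgebra mul \<Lambda> e (span C)"
  using assms unfolding generates_evolution_subalgebra_def evolution_subalgebra_def
  by (metis subset_image_iff)

context markov_evolution_algebra
begin

lemma linear_evolution_operator: "linear (evolution_operator mul \<Lambda> e)"
  unfolding evolution_operator_def
  using independent_generators by (rule linear_construct)

lemma evolution_operator_generator:
  "i \<in> \<Lambda> \<Longrightarrow> evolution_operator mul \<Lambda> e (e i) = mul (e i) (e i)"
  unfolding evolution_operator_def
  by (rule construct_basis[OF independent_generators]) simp

lemma evolution_operator_power_expansion:
  "(evolution_operator mul \<Lambda> e ^^ n) (e i) = (\<Sum>j\<in>\<Lambda>. evolution_coeff mul \<Lambda> e n i j *\<^sub>R e j)"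
proof -
  let ?x = "(evolution_operator mul \<Lambda> e ^^ n) (e i)"
  have "(\<Sum>b\<in>e ` \<Lambda>. representation (e ` \<Lambda>) ?x b *\<^sub>R b) = ?x"
    by (rule real_vector.sum_representation_eq[OF independent_generators])
       (use span_generators finite_index in auto)
  then show ?thesis
    by (simp add: sum.reindex[OF inj_generators] evolution_coeff_def)
qed

end

end

theory Submission
  imports Defs
begin

text \<open>
  The span of a set \<open>C\<close> of generators consists of the vectors whose coordinates outside \<open>C\<close>
  vanish (\<open>mem_span_subset_basis_iff\<close>).  The vanishing of all \<open>n\<^sub>i\<^sub>j\<close> with \<open>e\<^sub>i \<in> C\<close>,
  \<open>e\<^sub>j \<notin> C\<close> and \<open>n \<ge> 1\<close> therefore says that every positive power of the evolution operator
  \<open>L\<close> sends \<open>C\<close> into \<open>span C\<close>.  By linearity the first power already decides this: once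
  \<open>L\<close> sends \<open>C\<close> into \<open>span C\<close>, it preserves \<open>span C\<close>, and so do its iterates.

  On the other side, products of distinct generators vanish, so the only obstruction to
  \<open>span C\<close> being closed under multiplication is where the squares \<open>e\<^sub>i\<^sup>2 = L(e\<^sub>i)\<close> of the
  generators in \<open>C\<close> lie (\<open>span_generators_subalgebra_iff\<close>).  Both conditions thus say
  that \<open>L\<close> sends \<open>C\<close> into \<open>span C\<close>.
\<close>

text \<open>
  If the expansion of \<open>x\<close> over \<open>B\<close> only involves vectors of \<open>C\<close>, it exhibits \<open>x\<close> as a
  combination of \<open>C\<close>; conversely an expansion over \<open>C\<close> is one over \<open>B\<close>, and expansions
  over an independent set are unique.
\<close>

lemma mem_span_subset_basis_iff:
  fixes B :: "'a::real_vector set"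
  assumes "independent B" and "x \<in> span B" and "C \<subseteq> B"
  shows "x \<in> span C \<longleftrightarrow> (\<forall>b\<in>B - C. representation B x b = 0)"
proof
  assume "x \<in> span C"
  then have "representation B x = representation C x"
    using assms by (intro real_vector.representation_extend)
  then show "\<forall>b\<in>B - C. representation B x b = 0"
    using real_vector.representation_ne_zero by fastforce
next
  assume zero: "\<forall>b\<in>B - C. representation B x b = 0"
  have "representation B x b *\<^sub>R b \<in> span C" if "representation B x b \<noteq> 0" for b
    using that zero real_vector.representation_ne_zero[OF that]
    by (auto intro: real_vector.span_scale real_vector.span_base)
  then have "(\<Sum>b | representation B x b \<noteq> 0. representation B x b *\<^sub>R b) \<in> span C"
    by (intro real_vector.span_sum) simp
  then show "x \<in> span C"
    using real_vector.sum_nonzero_representation_eq[OF assms(1,2)] by simp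
qed

text \<open>
  Linearity in the second argument extends closure from \<open>C \<times> C\<close> to \<open>C \<times> span C\<close>, and
  linearity in the first then extends it to \<open>span C \<times> span C\<close>.
\<close>

lemma bilinear_mem_span:
  assumes "bilinear f"
    and closed: "\<And>a b. a \<in> C \<Longrightarrow> b \<in> C \<Longrightarrow> f a b \<in> span C"
    and "x \<in> span C" and "y \<in> span C"
  shows "f x y \<in> span C"
proof -
  have left: "linear (\<lambda>a. f a b)" and right: "linear (f a)" for a b
    using assms(1) by (auto simp: bilinear_def)
  have generator: "f a y \<in> span C" if "a \<in> C" for a
  proof -
    have "f a ` span C = span (f a ` C)"
      using linear_span_image[OF right] by simp
    also have "\<dots> \<subseteq> span C"
      using closed that by (intro real_vector.span_minimal) auto
    finally show ?thesis
      using assms(4) by blast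
  qed
  have "(\<lambda>a. f a y) ` span C = span ((\<lambda>a. f a y) ` C)"
    using linear_span_image[OF left] by simp
  also have "\<dots> \<subseteq> span C"
    using generator by (intro real_vector.span_minimal) auto
  finally show ?thesis
    using assms(3) by blast
qed

context markov_evolution_algebra
begin

text \<open>
  Among the products of two generators only the squares can be nonzero, and \<open>L\<close> takes
  exactly these squares as its values on generators.
\<close>

lemma span_generators_subalgebra_iff:
  assumes "C \<subseteq> e ` \<Lambda>"
  shows "is_subalgebra mul (span C) \<longleftrightarrow> evolution_operator mul \<Lambda> e ` C \<subseteq> span C"
proof
  assume "is_subalgebra mul (span C)"
  then show "evolution_operator mul \<Lambda> e ` C \<subseteq> span C"
    using assms evolution_operator_generator
    by (force simp: is_subalgebra_def intro: real_vector.span_base)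
next
  assume image: "evolution_operator mul \<Lambda> e ` C \<subseteq> span C"
  have "mul a b \<in> span C" if "a \<in> C" "b \<in> C" for a b
  proof (cases "a = b")
    case True
    then show ?thesis
      using that image assms evolution_operator_generator by force
  next
    case False
    then have "mul a b = 0"
      using that assms mul_distinct by blast
    then show ?thesis
      by (simp add: real_vector.span_zero)
  qed
  then show "is_subalgebra mul (span C)"
    using bilinear_mem_span[OF bilinear_mul] by (simp add: is_subalgebra_def)
qed

lemma evolution_operator_power_mem_span:
  assumes "evolution_operator mul \<Lambda> e ` C \<subseteq> span C" and "x \<in> span C"
  shows "(evolution_operator mul \<Lambda> e ^^ n) x \<in> span C"
proof (induction n)
  case 0
  show ?case using assms(2) by simp
next
  case (Suc n)
  have "evolution_operator mul \<Lambda> e ` span C \<subseteq> span C"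
    using assms(1)
    by (simp add: linear_span_image[OF linear_evolution_operator, symmetric] real_vector.span_minimal)
  then show ?case using Suc.IH by auto
qed

lemma evolution_power_mem_span_iff:
  assumes "C \<subseteq> e ` \<Lambda>"
  shows "(evolution_operator mul \<Lambda> e ^^ n) (e i) \<in> span C \<longleftrightarrow>
    (\<forall>j\<in>\<Lambda>. e j \<notin> C \<longrightarrow> evolution_coeff mul \<Lambda> e n i j = 0)"
  using mem_span_subset_basis_iff[OF independent_generators _ assms] span_generators
  by (auto simp: evolution_coeff_def)

end

theorem theorem2p13:
  fixes mul :: "'a::real_vector \<Rightarrow> 'a \<Rightarrow> 'a"
    and \<Lambda> :: "'i set"
    and e :: "'i \<Rightarrow> 'a"
    and p :: "'i \<Rightarrow> 'i \<Rightarrow> real"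
    and C :: "'a set"
  assumes "markov_evolution_algebra mul \<Lambda> e p"
    and "C \<subseteq> e ` \<Lambda>"
  shows "generates_evolution_subalgebra mul C \<longleftrightarrow>
    (\<forall>i\<in>\<Lambda>. \<forall>j\<in>\<Lambda>. \<forall>n\<ge>1. e i \<in> C \<longrightarrow> e j \<notin> C \<longrightarrow> evolution_coeff mul \<Lambda> e n i j = 0)"
proof -
  interpret markov_evolution_algebra mul \<Lambda> e p by fact
  let ?L = "evolution_operator mul \<Lambda> e"
  have "generates_evolution_subalgebra mul C \<longleftrightarrow> ?L ` C \<subseteq> span C"
    unfolding generates_evolution_subalgebra_def
    by (rule span_generators_subalgebra_iff[OF assms(2)])
  also have "\<dots> \<longleftrightarrow> (\<forall>i\<in>\<Lambda>. \<forall>n\<ge>1. e i \<in> C \<longrightarrow> (?L ^^ n) (e i) \<in> span C)"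
  proof
    assume "?L ` C \<subseteq> span C"
    then show "\<forall>i\<in>\<Lambda>. \<forall>n\<ge>1. e i \<in> C \<longrightarrow> (?L ^^ n) (e i) \<in> span C"
      by (blast intro: evolution_operator_power_mem_span real_vector.span_base)
  next
    assume powers: "\<forall>i\<in>\<Lambda>. \<forall>n\<ge>1. e i \<in> C \<longrightarrow> (?L ^^ n) (e i) \<in> span C"
    have "?L (e i) \<in> span C" if "i \<in> \<Lambda>" "e i \<in> C" for i
      using powers[rule_format, of i 1] that by simp
    then show "?L ` C \<subseteq> span C"
      using assms(2) by blast
  qed
  also have "\<dots> \<longleftrightarrow> (\<forall>i\<in>\<Lambda>. \<forall>j\<in>\<Lambda>. \<forall>n\<ge>1. e i \<in> C \<longrightarrow> e j \<notin> C \<longrightarrow>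
      evolution_coeff mul \<Lambda> e n i j = 0)"
    using evolution_power_mem_span_iff[OF assms(2)] by blast
  finally show ?thesis .
qed

end
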